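(* Let $n\in\mathbb N$. For $0\le k\le m\le n$ define $p_{m,k}(x)=\sum_{i=0}^k\binom{k}{i}(x-1)^iA_{m-i}(x)$, and for $k,j\ge0$ with $k+j\le n$ define $\ell_{n,k,j}(x)=\sum_{i=0}^k(-1)^i\binom{k}{i}p_{n-i,j}(x)$. Then for every $0\le k\le n$, the sequence $(\ell_{n,k,j}(x))_{0\le j\le n-k}$ is an interlacing sequence of real-rooted polynomials, and each of its terms is interlaced by the Eulerian polynomial $A_n(x)$.
   Context: $A_m(x)=\sum_{w\in\mathfrak S_m}x^{\mathrm{des}(w)}$ with $\mathrm{des}(w)=\#\{i\in[m-1]:w(i)>w(i+1)\}$ and $A_0(x)=1$; $A_m(x)$ is the $h$-polynomial of the barycentric subdivision of the $(m-1)$-dimensional simplex, so the polynomials $\ell_{n,k,j}$ are the polynomials $\ell_{\mathcal F,n,k,j}$ associated with the $f$-triangle $\mathcal F$ of barycentric subdivision. A polynomial is real-rooted if all its roots are real or it is zero. For real-rooted $f$ (roots $\alpha_1\ge\alpha_2\ge\cdots$) and $g$ (roots $\beta_1\ge\beta_2\ge\cdots$), $f\preceq g$ ("$f$ interlaces $g$") means $\cdots\le\alpha_2\le\beta_2\le\alpha_1\le\beta_1$; the zero polynomial interlaces and is interlaced by every real-rooted polynomial, and nonzero constants interlace every polynomial of degree at most one. A sequence $(f_0,\dots,f_m)$ of real-rooted polynomials is interlacing if $f_i\preceq f_j$ for all $0\le i<j\le m$. *)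

theory Defs
  imports
    Complex_Main
    "HOL-Computational_Algebra.Polynomial"
    "HOL-Combinatorics.Permutations"
begin

text \<open>The one-line word of a permutation is indexed by \<open>1, \<dots>, m\<close>.\<close>

definition des :: "nat \<Rightarrow> (nat \<Rightarrow> nat) \<Rightarrow> nat" where
  "des m w = card {i \<in> {1..<m}. w i > w (i + 1)}"

definition eulerian_poly :: "nat \<Rightarrow> real poly" where
  "eulerian_poly m = (\<Sum>w | w permutes {1..m}. monom 1 (des m w))"

lemma eulerian_poly_0: "eulerian_poly 0 = 1"
  by (simp add: eulerian_poly_def des_def)

text \<open>The polynomials \<open>p\<^sub>m\<^sub>,\<^sub>k(x)\<close>, meaningful for \<open>k \<le> m\<close>; \<open>[:-1, 1:]\<close> is \<open>x - 1\<close>.\<close>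

definition p_poly :: "nat \<Rightarrow> nat \<Rightarrow> real poly" where
  "p_poly m k = (\<Sum>i=0..k. of_nat (k choose i) * [:-1, 1:] ^ i * eulerian_poly (m - i))"

text \<open>The polynomials \<open>\<ell>\<^sub>n\<^sub>,\<^sub>k\<^sub>,\<^sub>j(x)\<close>, meaningful for \<open>k + j \<le> n\<close>.\<close>

definition ell_poly :: "nat \<Rightarrow> nat \<Rightarrow> nat \<Rightarrow> real poly" where
  "ell_poly n k j = (\<Sum>i=0..k. (-1) ^ i * of_nat (k choose i) * p_poly (n - i) j)"

definition real_rooted :: "real poly \<Rightarrow> bool" where
  "real_rooted f \<longleftrightarrow>
     f = 0 \<or> (\<forall>z::complex. poly (map_poly complex_of_real f) z = 0 \<longrightarrow> z \<in> \<real>)"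

text \<open>The real roots, with multiplicity, in weakly decreasing order.\<close>

definition roots_desc :: "real poly \<Rightarrow> real list" where
  "roots_desc f = rev (sorted_list_of_multiset (proots f))"

text \<open>
  With \<open>\<alpha> = roots_desc f\<close> and \<open>\<beta> = roots_desc g\<close> indexed from \<open>0\<close>, the chain
  \<open>\<dots> \<le> \<alpha>\<^sub>1 \<le> \<beta>\<^sub>1 \<le> \<alpha>\<^sub>0 \<le> \<beta>\<^sub>0\<close> alternates between the two lists and starts with \<open>\<beta>\<^sub>0\<close>, so it
  uses up all roots only if \<open>g\<close> has as many roots as \<open>f\<close> or exactly one more. In particular, a
  nonzero constant \<open>f\<close> interlaces every nonzero \<open>g\<close> of degree at most one.
\<close>

definition interlaces :: "real poly \<Rightarrow> real poly \<Rightarrow> bool" (infix "\<preceq>" 50) where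
  "f \<preceq> g \<longleftrightarrow> real_rooted f \<and> real_rooted g \<and>
     (f = 0 \<or> g = 0 \<or>
      (let \<alpha> = roots_desc f; \<beta> = roots_desc g in
        (length \<beta> = length \<alpha> \<or> length \<beta> = length \<alpha> + 1) \<and>
        (\<forall>i < length \<alpha>. \<alpha> ! i \<le> \<beta> ! i) \<and>
        (\<forall>i. i + 1 < length \<beta> \<longrightarrow> \<beta> ! (i + 1) \<le> \<alpha> ! i)))"

text \<open>Interlacing of the finite sequence \<open>(f\<^sub>0, \<dots>, f\<^sub>m)\<close>.\<close>

definition interlacing_seq :: "nat \<Rightarrow> (nat \<Rightarrow> real poly) \<Rightarrow> bool" where
  "interlacing_seq m f \<longleftrightarrow>
     (\<forall>i\<le>m. real_rooted (f i)) \<and> (\<forall>i j. i < j \<and> j \<le> m \<longrightarrow> f i \<preceq> f j)"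

end

theory Submission
  imports Defs "HOL-Combinatorics.Multiset_Permutations"
begin

text \<open>
  Two real-rooted polynomials interlace, \<open>f \<preceq> g\<close>, exactly when their root-counting functions
  \<open>N\<^sub>f(t)\<close>, the number of roots of \<open>f\<close> that are at least \<open>t\<close>, satisfy \<open>N\<^sub>f \<le> N\<^sub>g \<le> N\<^sub>f + 1\<close>.
  Hence a chain \<open>f\<^sub>0 \<preceq> f\<^sub>1 \<preceq> \<dots> \<preceq> f\<^sub>m\<close> with \<open>f\<^sub>0 \<preceq> f\<^sub>m\<close> is an interlacing sequence.

  For \<open>k = 0\<close>, the polynomial \<open>\<ell>\<^sub>n\<^sub>,\<^sub>0\<^sub>,\<^sub>j = p\<^sub>n\<^sub>,\<^sub>j\<close> enumerates by descents the permutations of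
  \<open>n + 1\<close> letters that begin with \<open>j + 1\<close>. Deleting the first letter gives
  \<open>p\<^sub>n\<^sub>+\<^sub>1\<^sub>,\<^sub>j = x \<Sum>\<^sub>i\<^sub><\<^sub>j p\<^sub>n\<^sub>,\<^sub>i + \<Sum>\<^sub>i\<^sub>\<ge>\<^sub>j p\<^sub>n\<^sub>,\<^sub>i\<close>, a recurrence that preserves interlacing. Passing from \<open>k\<close>
  to \<open>k + 1\<close> rests on \<open>(x - 1) \<ell>\<^sub>n\<^sub>,\<^sub>k\<^sub>+\<^sub>1\<^sub>,\<^sub>j = x \<ell>\<^sub>n\<^sub>,\<^sub>k\<^sub>,\<^sub>j - \<ell>\<^sub>n\<^sub>,\<^sub>k\<^sub>,\<^sub>j\<^sub>+\<^sub>1\<close>: the right-hand side has its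
  largest root at \<open>1\<close>, and dividing it out leaves a polynomial whose root-counting function lies
  between those of \<open>\<ell>\<^sub>n\<^sub>,\<^sub>k\<^sub>,\<^sub>j\<close> and \<open>\<ell>\<^sub>n\<^sub>,\<^sub>k\<^sub>,\<^sub>j\<^sub>+\<^sub>1\<close>.
\<close>

section \<open>Counting roots\<close>

definition roots_ge :: "real poly \<Rightarrow> real \<Rightarrow> nat" where
  "roots_ge f t = size {#r \<in># proots f. t \<le> r#}"

text \<open>The strict count governs the sign of f at t; it differs from \<open>roots_ge\<close> by
  the multiplicity of t as a root.\<close>

definition roots_gt :: "real poly \<Rightarrow> real \<Rightarrow> nat" where
  "roots_gt f t = size {#r \<in># proots f. t < r#}"

text \<open>Real-rootedness of a nonzero polynomial in terms of its real roots alone.\<close>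

definition splits :: "real poly \<Rightarrow> bool" where
  "splits f \<longleftrightarrow> f \<noteq> 0 \<and> size (proots f) = degree f"

definition alternates :: "real poly \<Rightarrow> real poly \<Rightarrow> bool" (infix "\<unlhd>" 50) where
  "f \<unlhd> g \<longleftrightarrow> (\<forall>t. roots_ge f t \<le> roots_ge g t \<and> roots_ge g t \<le> roots_ge f t + 1)"

section \<open>Splitting off linear factors\<close>

lemma proots_linear_mult:
  fixes f :: "real poly"
  assumes "f \<noteq> 0"
  shows "proots ([:-r, 1:] * f) = add_mset r (proots f)"
  using assms by (subst proots_mult) (auto simp: proots_linear_factor)

lemma degree_linear_mult:
  fixes f :: "real poly"
  assumes "f \<noteq> 0"
  shows "degree ([:-r, 1:] * f) = Suc (degree f)"
  using assms by (subst degree_mult_eq) auto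

lemma lead_coeff_linear_mult:
  fixes f :: "real poly"
  shows "lead_coeff ([:-r, 1:] * f) = lead_coeff f"
  by (subst lead_coeff_mult) auto

lemma splits_linear_mult_iff: "splits ([:-r, 1:] * f) \<longleftrightarrow> splits f"
proof (cases "f = 0")
  case False
  then have "[:-r, 1:] * f \<noteq> 0" by (metis mult_eq_0_iff pCons_eq_0_iff one_neq_zero)
  with False show ?thesis
    unfolding splits_def proots_linear_mult[OF False] degree_linear_mult[OF False] by simp
qed (simp add: splits_def)

lemma roots_ge_linear_mult:
  assumes "f \<noteq> 0"
  shows "roots_ge ([:-r, 1:] * f) t = (if t \<le> r then 1 else 0) + roots_ge f t"
  unfolding roots_ge_def proots_linear_mult[OF assms] by simp

lemma roots_gt_linear_mult:
  assumes "f \<noteq> 0"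
  shows "roots_gt ([:-r, 1:] * f) t = (if t < r then 1 else 0) + roots_gt f t"
  unfolding roots_gt_def proots_linear_mult[OF assms] by simp

lemma alternates_linear_mult_iff:
  assumes "f \<noteq> 0" "g \<noteq> 0"
  shows "[:-r, 1:] * f \<unlhd> [:-r, 1:] * g \<longleftrightarrow> f \<unlhd> g"
  unfolding alternates_def roots_ge_linear_mult[OF assms(1)] roots_ge_linear_mult[OF assms(2)]
  by simp

lemma splits_induct [consumes 1, case_names const linear]:
  assumes "splits f"
    and const: "\<And>c. c \<noteq> 0 \<Longrightarrow> P [:c:]"
    and linear: "\<And>r f. splits f \<Longrightarrow> P f \<Longrightarrow> P ([:-r, 1:] * f)"
  shows "P f"
  using assms(1)
proof (induction "degree f" arbitrary: f)
  case 0
  then obtain c where "f = [:c:]" by (metis degree_eq_zeroE)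
  with 0 const show ?case by (auto simp: splits_def)
next
  case (Suc d)
  then have f0: "f \<noteq> 0" and "proots f \<noteq> {#}" by (auto simp: splits_def)
  then obtain r where "r \<in># proots f" by blast
  with f0 have "poly f r = 0" by simp
  then obtain h where h: "f = [:-r, 1:] * h" by (meson dvdE poly_eq_0_iff_dvd)
  then have "splits h" using Suc.prems splits_linear_mult_iff by blast
  moreover have "h \<noteq> 0" using f0 h by auto
  then have "d = degree h" using Suc.hyps(2) h degree_linear_mult by auto
  ultimately show ?case using Suc.hyps(1) linear h by blast
qed

lemma map_poly_of_real_mult:
  "map_poly complex_of_real (f * g) = map_poly complex_of_real f * map_poly complex_of_real g"
  by (rule poly_eqI) (simp add: coeff_map_poly coeff_mult)

lemma splits_imp_real_rooted:
  assumes "splits f"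
  shows "real_rooted f"
proof -
  have "z \<in> \<real>" if "poly (map_poly complex_of_real f) z = 0" for z
    using assms that
  proof (induction rule: splits_induct)
    case (const c)
    then show ?case by (simp add: map_poly_pCons)
  next
    case (linear r f)
    have "poly (map_poly complex_of_real [:-r, 1:]) z = z - of_real r"
      by (simp add: map_poly_pCons)
    with linear show ?case
      unfolding map_poly_of_real_mult poly_mult
      by (metis Reals_of_real eq_iff_diff_eq_0 mult_eq_0_iff)
  qed
  then show ?thesis by (simp add: real_rooted_def)
qed

text \<open>Dividing out the known real roots leaves degree at most one, and a linear real
  polynomial has a real root.\<close>

lemma splits_if_few_missing_roots:
  assumes "f \<noteq> 0" "degree f \<le> size (proots f) + 1"
  shows "splits f"
  using assms
proof (induction "degree f" arbitrary: f)
  case 0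
  then show ?case using size_proots_le[of f] by (simp add: splits_def)
next
  case (Suc d)
  show ?case
  proof (cases "d = 0")
    case True
    obtain a q where q: "f = pCons a q" by (cases f)
    with True Suc.hyps(2) have "degree q = 0" by (auto simp: degree_pCons_eq_if split: if_splits)
    then obtain b where "q = [:b:]" by (rule degree_eq_zeroE)
    with q Suc.hyps(2) have ab: "f = [:a, b:]" "b \<noteq> 0" by (auto split: if_splits)
    have "f = smult b [:a/b, 1:]" using ab by simp
    then have "proots f = {#-(a/b)#}" by (metis ab(2) proots_smult proots_linear_factor)
    then show ?thesis using True Suc by (simp add: splits_def)
  next
    case False
    then have "proots f \<noteq> {#}" using Suc by auto
    then obtain r where "r \<in># proots f" by blast
    with Suc.prems have "poly f r = 0" by simp
    then obtain h where h: "f = [:-r, 1:] * h" by (meson dvdE poly_eq_0_iff_dvd)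
    moreover have h0: "h \<noteq> 0" using Suc.prems h by auto
    moreover have "d = degree h" using Suc.hyps(2) h degree_linear_mult[OF h0] by auto
    moreover have "size (proots f) = Suc (size (proots h))"
      unfolding h proots_linear_mult[OF h0] by simp
    ultimately have "splits h" using Suc by auto
    then show ?thesis using h splits_linear_mult_iff by blast
  qed
qed

text \<open>Each root r above t contributes one negative factor t - r.\<close>

lemma sign_poly_splits:
  assumes "splits f" "lead_coeff f > 0" "poly f t \<noteq> 0"
  shows "(-1) ^ roots_gt f t * poly f t > 0"
  using assms
proof (induction rule: splits_induct)
  case (const c)
  then show ?case by (simp add: roots_gt_def)
next
  case (linear r f)
  then have "f \<noteq> 0" by (simp add: splits_def)
  have "(-1) ^ roots_gt f t * poly f t > 0" "t \<noteq> r"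
    using linear by (auto simp only: lead_coeff_linear_mult poly_mult) auto
  moreover have "poly ([:-r, 1:] * f) t = (t - r) * poly f t" by (simp add: algebra_simps)
  moreover have "0 < (if t < r then -1 else 1) * (t - r)" using \<open>t \<noteq> r\<close> by auto
  then have "0 < ((if t < r then -1 else 1) * (t - r)) * ((-1) ^ roots_gt f t * poly f t)"
    using \<open>(-1) ^ roots_gt f t * poly f t > 0\<close> by (rule mult_pos_pos)
  moreover have "(-1) ^ roots_gt ([:-r, 1:] * f) t =
      (if t < r then -1 else 1) * (-1::real) ^ roots_gt f t"
    unfolding roots_gt_linear_mult[OF \<open>f \<noteq> 0\<close>] by simp
  ultimately show ?case by (simp only: ac_simps)
qed

lemma roots_ge_eq_gt:
  assumes "f \<noteq> 0"
  shows "roots_ge f t = roots_gt f t + order t f"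
proof -
  have "{#r \<in># proots f. t \<le> r#} = {#r \<in># proots f. t < r#} + {#r \<in># proots f. r = t#}"
    by (rule multiset_eqI) auto
  moreover have "size {#r \<in># proots f. r = t#} = order t f"
    using assms by (metis count_proots filter_eq_replicate_mset size_replicate_mset)
  ultimately show ?thesis by (simp add: roots_ge_def roots_gt_def)
qed

lemma roots_ge_antimono: "s \<le> t \<Longrightarrow> roots_ge f t \<le> roots_ge f s"
  unfolding roots_ge_def
  by (rule size_mset_mono) (auto simp: subseteq_mset_def)

lemma roots_ge_le_gt: "s < t \<Longrightarrow> roots_ge f t \<le> roots_gt f s"
  unfolding roots_ge_def roots_gt_def
  by (rule size_mset_mono) (auto simp: subseteq_mset_def)

text \<open>If u is the least root of f or g above t, the strict counts at t are the weak counts at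
  u.\<close>

lemma alternates_roots_gt:
  assumes "f \<unlhd> g"
  shows "roots_gt f t \<le> roots_gt g t \<and> roots_gt g t \<le> roots_gt f t + 1"
proof -
  \<comment> \<open>The element t + 1 keeps S nonempty when no root exceeds t.\<close>
  define S where "S = insert (t + 1) {r \<in> set_mset (proots f) \<union> set_mset (proots g). t < r}"
  have S: "finite S" "S \<noteq> {}" by (auto simp: S_def)
  define u where "u = Min S"
  have "u \<in> S" using S by (simp add: u_def)
  then have "t < u" by (auto simp: S_def)
  have min: "u \<le> r" if "r \<in> S" for r using S that by (simp add: u_def)
  have "{#r \<in># proots h. t < r#} = {#r \<in># proots h. u \<le> r#}" if "h = f \<or> h = g" for h
    using that min \<open>t < u\<close> by (intro filter_mset_cong) (auto simp: S_def)
  then have "roots_gt h t = roots_ge h u" if "h = f \<or> h = g" for h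
    using that by (simp add: roots_ge_def roots_gt_def)
  then show ?thesis using assms by (simp add: alternates_def)
qed

lemma roots_low:
  assumes "finite H"
  obtains t where "\<And>f. f \<in> H \<Longrightarrow> roots_ge f t = size (proots f)"
proof
  define S where "S = insert 0 (\<Union>f\<in>H. set_mset (proots f))"
  have S: "finite S" using assms by (auto simp: S_def)
  fix f assume "f \<in> H"
  then have "{#r \<in># proots f. Min S \<le> r#} = proots f"
    using S by (subst filter_mset_eq_conv) (auto simp: S_def intro!: Min_le)
  then show "roots_ge f (Min S) = size (proots f)" by (simp add: roots_ge_def)
qed

lemma alternates_degree:
  assumes "splits f" "splits g" "f \<unlhd> g"
  shows "degree f \<le> degree g \<and> degree g \<le> degree f + 1"
proof -
  obtain t where "\<And>h. h \<in> {f, g} \<Longrightarrow> roots_ge h t = size (proots h)"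
    using roots_low[of "{f, g}"] by blast
  then have "roots_ge f t = degree f" "roots_ge g t = degree g"
    using assms by (auto simp: splits_def)
  then show ?thesis using assms(3) unfolding alternates_def by metis
qed

text \<open>In a weakly decreasing list the entries at least t form an initial segment.\<close>

lemma less_length_filter_ge_iff:
  assumes "sorted_wrt (\<ge>) xs"
  shows "i < length (filter (\<lambda>r. t \<le> r) xs) \<longleftrightarrow> i < length xs \<and> (t::real) \<le> xs ! i"
  using assms
proof (induction xs arbitrary: i)
  case (Cons x xs)
  have "filter (\<lambda>r. t \<le> r) xs = []" if "\<not> t \<le> x"
    using Cons.prems that by (auto simp: filter_empty_conv)
  moreover have "xs ! j \<le> x" if "j < length xs" for j
    using Cons.prems that by auto
  ultimately show ?case using Cons by (cases i) force+
qed simp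

lemma less_roots_ge_iff:
  "i < roots_ge f t \<longleftrightarrow> i < length (roots_desc f) \<and> t \<le> roots_desc f ! i"
proof -
  have "mset (roots_desc f) = proots f" by (simp add: roots_desc_def)
  then have "roots_ge f t = length (filter (\<lambda>r. t \<le> r) (roots_desc f))"
    unfolding roots_ge_def by (metis mset_filter size_mset)
  moreover have "sorted_wrt (\<ge>) (roots_desc f)"
    by (simp add: roots_desc_def sorted_wrt_rev)
  ultimately show ?thesis by (simp add: less_length_filter_ge_iff)
qed

text \<open>The inequalities between sorted roots come from comparing the counts at t = \<alpha>_i
  and at t = \<beta>_(i+1).\<close>

lemma alternates_imp_interlaces:
  assumes "splits f" "splits g" "f \<unlhd> g"
  shows "f \<preceq> g"
proof -
  have len: "length (roots_desc h) = size (proots h)" for h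
    by (simp add: roots_desc_def flip: size_mset)
  have le: "roots_ge f t \<le> roots_ge g t" "roots_ge g t \<le> roots_ge f t + 1" for t
    using assms(3) by (auto simp: alternates_def)
  have "roots_desc f ! i \<le> roots_desc g ! i" if "i < length (roots_desc f)" for i
    using that less_roots_ge_iff le(1) by (meson order_refl order_less_le_trans)
  moreover have "roots_desc g ! (i + 1) \<le> roots_desc f ! i" if "i + 1 < length (roots_desc g)" for i
  proof -
    have "i + 1 < roots_ge g (roots_desc g ! (i + 1))"
      using that less_roots_ge_iff by blast
    then have "i < roots_ge f (roots_desc g ! (i + 1))"
      using le(2) by (meson add_less_cancel_right order_less_le_trans)
    then show ?thesis using less_roots_ge_iff by blast
  qed
  ultimately show ?thesis
    using assms alternates_degree[OF assms] splits_imp_real_rooted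
    unfolding interlaces_def Let_def len by (auto simp: splits_def)
qed

section \<open>Interlacing from sign changes\<close>

lemma card_roots_le_size:
  assumes "finite X" "X \<subseteq> {r. poly f r = 0 \<and> Q r}" "f \<noteq> 0"
  shows "card X \<le> size {#r \<in># proots f. Q r#}"
proof -
  have "mset_set X \<subseteq># {#r \<in># proots f. Q r#}"
  proof (rule mset_subset_eqI)
    fix r
    show "count (mset_set X) r \<le> count {#r \<in># proots f. Q r#} r"
      using assms by (cases "r \<in> X") (auto simp: count_mset_set Suc_le_eq order_gt_0_iff)
  qed
  then show ?thesis by (metis size_mset_mono size_mset_set)
qed

lemma size_filter_simple_roots:
  assumes "a \<noteq> 0" "\<And>r. poly a r = 0 \<Longrightarrow> order r a = 1"
  shows "size {#r \<in># proots a. Q r#} = card {r. poly a r = 0 \<and> Q r}"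
proof -
  have "finite {r. poly a r = 0 \<and> Q r}"
    using poly_roots_finite[OF assms(1)] by (rule rev_finite_subset) auto
  then have "{#r \<in># proots a. Q r#} = mset_set {r. poly a r = 0 \<and> Q r}"
    using assms by (intro multiset_eqI) (auto simp: count_mset_set' order_0I)
  then show ?thesis by simp
qed

text \<open>The prescribed sign of g flips between consecutive roots of a; at the largest root it is
  negative, while g is eventually positive. The intermediate value theorem does the rest.\<close>

lemma simple_roots_sign_change:
  fixes a g :: "real poly"
  assumes a: "a \<noteq> 0" "\<And>r. poly a r = 0 \<Longrightarrow> order r a = 1"
    and lead: "lead_coeff g > 0"
    and sign: "\<And>r. poly a r = 0 \<Longrightarrow> (-1) ^ (roots_gt a r + 1) * poly g r > 0"
    and r: "poly a r = 0"
  shows "\<exists>y>r. poly g y = 0 \<and> (\<forall>r'>r. poly a r' = 0 \<longrightarrow> y < r')"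
proof -
  define S where "S = {r'. poly a r' = 0 \<and> r < r'}"
  have fin: "finite S"
    using poly_roots_finite[OF a(1)] by (rule rev_finite_subset) (auto simp: S_def)
  have gt: "roots_gt a u = card {r'. poly a r' = 0 \<and> u < r'}" for u
    unfolding roots_gt_def using size_filter_simple_roots[OF a] .
  show ?thesis
  proof (cases "S = {}")
    case True
    then have "roots_gt a r = 0" unfolding gt S_def by (metis card.empty)
    with sign[OF r] have "poly g r < 0" by simp
    obtain n where n: "\<And>x. x \<ge> n \<Longrightarrow> poly g x \<ge> lead_coeff g"
      using poly_pinfty_gt_lc[OF lead] by blast
    have "poly g (max n (r + 1)) > 0" using n[of "max n (r + 1)"] lead by linarith
    then obtain y where "r < y" "poly g y = 0"
      using poly_IVT_pos[of r "max n (r + 1)" g] \<open>poly g r < 0\<close> by (auto simp: less_max_iff_disj)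
    then show ?thesis using True by (auto simp: S_def)
  next
    case False
    define u where "u = Min S"
    have u: "u \<in> S" using fin False by (simp add: u_def)
    have S: "S = insert u {r'. poly a r' = 0 \<and> u < r'}"
    proof (intro equalityI subsetI)
      fix v assume "v \<in> S"
      moreover from this have "u \<le> v" using fin by (simp add: u_def)
      ultimately show "v \<in> insert u {r'. poly a r' = 0 \<and> u < r'}"
        by (auto simp: S_def)
    qed (use u in \<open>auto simp: S_def\<close>)
    have "finite {r'. poly a r' = 0 \<and> u < r'}" using fin S by (metis finite_insert)
    then have "roots_gt a r = Suc (roots_gt a u)"
      unfolding gt S_def[symmetric] S by (subst card_insert_disjoint) auto
    moreover have "poly a u = 0" "r < u" using u by (auto simp: S_def)
    ultimately have "((-1) ^ (roots_gt a r + 1) * poly g r) * ((-1) ^ (roots_gt a u + 1) * poly g u)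
        = - (poly g r * poly g u) * ((-1) ^ (roots_gt a u) * (-1) ^ (roots_gt a u))" by simp
    moreover have "(-1) ^ (roots_gt a u) * (-1) ^ (roots_gt a u) = (1::real)"
      by (simp flip: power_mult_distrib)
    ultimately have "poly g r * poly g u < 0"
      using mult_pos_pos[OF sign[OF r] sign[OF \<open>poly a u = 0\<close>]] by simp
    then obtain y where "r < y" "y < u" "poly g y = 0"
      using poly_IVT[OF \<open>r < u\<close>] by blast
    moreover have "u \<le> r'" if "r' > r" "poly a r' = 0" for r'
      using that fin by (simp add: u_def S_def)
    ultimately show ?thesis by force
  qed
qed

text \<open>Each root r of a yields a root of g before the next root of a. At most one root of g
  remains, so g splits, and parity shows that g has exactly one more root above r than a.\<close>

lemma alternates_simple_roots:
  fixes a g :: "real poly"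
  assumes split_a: "splits a" and simple: "\<And>r. poly a r = 0 \<Longrightarrow> order r a = 1"
    and deg: "degree g \<le> degree a + 1" and lead: "lead_coeff g > 0"
    and sign: "\<And>r. poly a r = 0 \<Longrightarrow> (-1) ^ (roots_gt a r + 1) * poly g r > 0"
  shows "splits g \<and> a \<unlhd> g"
proof -
  have a0: "a \<noteq> 0" using split_a by (simp add: splits_def)
  have g0: "g \<noteq> 0" using lead by auto
  note a = a0 simple
  define R where "R = {r. poly a r = 0}"
  have finR: "finite R" using poly_roots_finite[OF a0] by (simp add: R_def)
  have "\<forall>r\<in>R. \<exists>y>r. poly g y = 0 \<and> (\<forall>r'>r. poly a r' = 0 \<longrightarrow> y < r')"
    using simple_roots_sign_change[OF a lead sign] by (simp add: R_def)
  from bchoice[OF this] obtain y where y: "\<And>r. r \<in> R \<Longrightarrow> r < y r \<and> poly g (y r) = 0"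
      "\<And>r r'. r \<in> R \<Longrightarrow> r' \<in> R \<Longrightarrow> r < r' \<Longrightarrow> y r < r'"
    by (auto simp: R_def)
  have inj: "inj_on y R"
    by (rule linorder_inj_onI') (metis y order_less_trans order_less_irrefl)
  have count_a: "size {#r \<in># proots a. Q r#} = card {r \<in> R. Q r}" for Q
    using size_filter_simple_roots[OF a] by (simp add: R_def)
  have count_g: "card {r \<in> R. Q (y r)} \<le> size {#r \<in># proots g. Q r#}" for Q
  proof -
    have "card {r \<in> R. Q (y r)} = card (y ` {r \<in> R. Q (y r)})"
      by (rule card_image[symmetric]) (rule inj_on_subset[OF inj], auto)
    also have "\<dots> \<le> size {#r \<in># proots g. Q r#}"
      using finR y g0 by (intro card_roots_le_size) auto
    finally show ?thesis .
  qed
  have degR: "degree a = card R"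
    using count_a[of "\<lambda>_. True"] split_a by (simp add: splits_def)
  have "splits g"
    using count_g[of "\<lambda>_. True"] deg degR g0 by (intro splits_if_few_missing_roots) auto
  have mono_card: "card {r \<in> R. Q r} \<le> card {r \<in> R. Q' r}" if "\<And>r. r \<in> R \<Longrightarrow> Q r \<Longrightarrow> Q' r" for Q Q'
    using that finR by (intro card_mono) auto
  have lower: "roots_ge a t \<le> roots_ge g t" for t
  proof -
    have "roots_ge a t = card {r \<in> R. t \<le> r}" by (simp add: roots_ge_def count_a)
    also have "\<dots> \<le> card {r \<in> R. t \<le> y r}" using y by (intro mono_card) force
    finally show ?thesis using count_g[of "\<lambda>r. t \<le> r"] by (simp add: roots_ge_def)
  qed
  have at_root: "roots_gt g r = roots_gt a r + 1" if "r \<in> R" for r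
  proof -
    have "poly a r = 0" using that by (simp add: R_def)
    have ge: "card {s \<in> R. r \<le> s} = roots_gt a r + 1"
      using roots_ge_eq_gt[OF a0, of r] simple[OF \<open>poly a r = 0\<close>]
      by (simp add: roots_ge_def count_a)
    have "card {s \<in> R. r \<le> s} \<le> card {s \<in> R. r < y s}"
      using y by (intro mono_card) force
    then have lo: "roots_gt a r + 1 \<le> roots_gt g r"
      using count_g[of "\<lambda>s. r < s"] ge by (simp add: roots_gt_def)
    \<comment> \<open>g has at most \<open>card R + 1\<close> roots, and each s < r in R contributes
      a root \<open>y s\<close> below r. This leaves at most \<open>roots_gt a r + 2\<close> roots
      above r.\<close>
    have "R = {s \<in> R. r \<le> s} \<union> {s \<in> R. s < r}" by auto
    then have "card R = card {s \<in> R. r \<le> s} + card {s \<in> R. s < r}"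
      using finR by (metis (no_types, lifting) card_Un_disjoint finite_Un disjoint_iff
          mem_Collect_eq not_less)
    moreover have "card {s \<in> R. s < r} \<le> card {s \<in> R. y s < r}"
      using y that by (intro mono_card) force
    then have "card {s \<in> R. s < r} \<le> size {#s \<in># proots g. s < r#}"
      using count_g[of "\<lambda>s. s < r"] by simp
    moreover have "proots g = {#s \<in># proots g. r < s#} + {#s \<in># proots g. \<not> r < s#}"
      by simp
    then have "degree g = roots_gt g r + size {#s \<in># proots g. \<not> r < s#}"
      using \<open>splits g\<close> unfolding splits_def roots_gt_def by (metis size_union)
    moreover have "size {#s \<in># proots g. s < r#} \<le> size {#s \<in># proots g. \<not> r < s#}"
      by (rule size_mset_mono) (auto simp: subseteq_mset_def)
    ultimately have hi: "roots_gt g r \<le> roots_gt a r + 2"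
      using deg degR ge by linarith
    have "poly g r \<noteq> 0" using sign[OF \<open>poly a r = 0\<close>] by auto
    from sign_poly_splits[OF \<open>splits g\<close> lead this] sign[OF \<open>poly a r = 0\<close>]
    have "(-1) ^ roots_gt g r * poly g r > 0" "(-1) ^ (roots_gt a r + 1) * poly g r > 0" by auto
    \<comment> \<open>The sign of \<open>g\<close> at \<open>r\<close> fixes the parity of the number of roots above \<open>r\<close>.\<close>
    then have "roots_gt g r \<noteq> roots_gt a r + 2" by (auto simp: power_add)
    with lo hi show ?thesis by linarith
  qed
  \<comment> \<open>Compare at the largest root r of a below t: every root of g from t on lies above
    r. Without such an r the degree bound suffices.\<close>
  have upper: "roots_ge g t \<le> roots_ge a t + 1" for t
  proof (cases "{r \<in> R. r < t} = {}")
    case True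
    then have "{r \<in> R. t \<le> r} = R" by force
    then have "roots_ge a t = degree a" by (simp add: roots_ge_def count_a degR)
    moreover have "roots_ge g t \<le> degree g"
      unfolding roots_ge_def by (meson size_proots_le size_filter_mset_lesseq order_trans)
    ultimately show ?thesis using deg by simp
  next
    case False
    define r where "r = Max {r \<in> R. r < t}"
    have "r \<in> {r \<in> R. r < t}" unfolding r_def using finR False by (intro Max_in) auto
    then have r: "r \<in> R" "r < t" by auto
    have "s \<le> r" if "s \<in> R" "s < t" for s using that finR by (simp add: r_def)
    then have "roots_gt a r \<le> roots_ge a t"
      unfolding roots_gt_def roots_ge_def count_a by (intro mono_card) force
    then show ?thesis using roots_ge_le_gt[OF r(2), of g] at_root[OF r(1)] by simp
  qed
  show ?thesis using \<open>splits g\<close> lower upper by (simp add: alternates_def)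
qed

text \<open>Since r is counted once in \<open>roots_ge a r\<close> and b does not vanish there, the
  weak and strict bounds force \<open>roots_gt b r = roots_gt a r + 1\<close>.\<close>

lemma alternates_sign_at_root:
  assumes "splits a" "splits b" "a \<unlhd> b" "lead_coeff b > 0" "poly a r = 0"
    "order r a = 1" "poly b r \<noteq> 0"
  shows "(-1) ^ (roots_gt a r + 1) * poly b r > 0"
proof -
  have nz: "a \<noteq> 0" "b \<noteq> 0" using assms by (auto simp: splits_def)
  have "roots_ge a r = roots_gt a r + 1" using roots_ge_eq_gt[OF nz(1)] assms by simp
  moreover have "roots_ge b r = roots_gt b r"
    using roots_ge_eq_gt[OF nz(2)] assms order_0I by simp
  ultimately have "roots_gt b r = roots_gt a r + 1"
    using assms(3) alternates_roots_gt[OF assms(3), of r] unfolding alternates_def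
    by (metis le_antisym)
  then show ?thesis using sign_poly_splits[OF assms(2,4,7)] by simp
qed

text \<open>At r the count of a jumps by at least two, which b can only follow by jumping at r
  itself.\<close>

lemma alternates_multiple_root:
  assumes "splits a" "splits b" "a \<unlhd> b" "order r a \<ge> 2"
  shows "poly b r = 0"
proof -
  have nz: "a \<noteq> 0" "b \<noteq> 0" using assms by (auto simp: splits_def)
  have "roots_ge a r \<le> roots_ge b r" "roots_gt b r \<le> roots_gt a r + 1"
    using assms(3) alternates_roots_gt[OF assms(3), of r] by (auto simp: alternates_def)
  then have "order r b \<noteq> 0"
    using roots_ge_eq_gt[OF nz(1), of r] roots_ge_eq_gt[OF nz(2), of r] assms(4) by linarith
  then show ?thesis by (metis order_0I)
qed

text \<open>
  Roots common to \<open>a\<close>, \<open>b\<close> and \<open>b'\<close> are also roots of \<open>g\<close> and can be divided out. Afterwards \<open>a\<close> has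
  only simple roots, and at each of them \<open>b\<close> and \<open>b'\<close>, hence \<open>g\<close>, have the sign that interlacing
  prescribes.
\<close>

lemma alternates_combination:
  fixes a b b' g p s :: "real poly"
  assumes "splits a" "splits b" "splits b'" "a \<unlhd> b" "a \<unlhd> b'"
    and "lead_coeff b > 0" "lead_coeff b' > 0" "lead_coeff g > 0"
    and "degree g \<le> degree a + 1"
    and "p * g = b + b' + s * a" "\<And>r. poly a r = 0 \<Longrightarrow> poly p r > 0"
  shows "splits g \<and> a \<unlhd> g"
  using assms
proof (induction "degree a" arbitrary: a b b' g rule: less_induct)
  case less
  have nz: "a \<noteq> 0" "b \<noteq> 0" "b' \<noteq> 0" "g \<noteq> 0" using less.prems by (auto simp: splits_def)
  have pg: "poly p r * poly g r = poly b r + poly b' r" if "poly a r = 0" for r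
    using arg_cong[OF less.prems(10), of "\<lambda>q. poly q r"] that by simp
  show ?case
  proof (cases "\<exists>r. poly a r = 0 \<and> poly b r = 0 \<and> poly b' r = 0")
    case True
    then obtain r where r: "poly a r = 0" "poly b r = 0" "poly b' r = 0" by blast
    then have "poly g r = 0" using pg[OF r(1)] less.prems(11)[OF r(1)] by auto
    with r obtain a1 b1 b1' g1 where f:
      "a = [:-r,1:] * a1" "b = [:-r,1:] * b1" "b' = [:-r,1:] * b1'" "g = [:-r,1:] * g1"
      by (meson dvdE poly_eq_0_iff_dvd)
    have nz1: "a1 \<noteq> 0" "b1 \<noteq> 0" "b1' \<noteq> 0" "g1 \<noteq> 0" using nz f by auto
    have "[:-r,1:] * (p * g1) = [:-r,1:] * (b1 + b1' + s * a1)"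
      using less.prems(10) unfolding f by (simp only: algebra_simps)
    moreover have "[:-r,1:] \<noteq> 0" by simp
    ultimately have "p * g1 = b1 + b1' + s * a1" by (metis mult_left_cancel)
    moreover have "degree a1 < degree a" unfolding f(1) degree_linear_mult[OF nz1(1)] by simp
    moreover have "poly p t > 0" if "poly a1 t = 0" for t
      using less.prems(11)[of t] that by (simp add: f(1) poly_mult)
    moreover have "degree g1 \<le> degree a1 + 1"
      using less.prems(9) unfolding f degree_linear_mult[OF nz1(1)] degree_linear_mult[OF nz1(4)] by simp
    ultimately have "splits g1 \<and> a1 \<unlhd> g1"
      using less.prems(1-8)
      unfolding f(2-4) splits_linear_mult_iff lead_coeff_linear_mult
      unfolding f(1) splits_linear_mult_iff alternates_linear_mult_iff[OF nz1(1,2)]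
        alternates_linear_mult_iff[OF nz1(1,3)]
      by (intro less.hyps[of a1 b1 b1' g1, unfolded f(1)])
    then show ?thesis unfolding f splits_linear_mult_iff using nz1 alternates_linear_mult_iff by blast
  next
    case False
    \<comment> \<open>A multiple root of a would be a root of b and of b' as well.\<close>
    have simple: "order r a = 1" if "poly a r = 0" for r
    proof -
      have "order r a \<noteq> 0" using that nz order_root by blast
      moreover have "\<not> order r a \<ge> 2"
        using alternates_multiple_root[OF less.prems(1,2,4)]
          alternates_multiple_root[OF less.prems(1,3,5)] False that by blast
      ultimately show ?thesis by linarith
    qed
    have "(-1) ^ (roots_gt a r + 1) * poly g r > 0" if r: "poly a r = 0" for r
    proof -
      let ?e = "(-1) ^ (roots_gt a r + 1) :: real"
      have "poly b r \<noteq> 0 \<Longrightarrow> ?e * poly b r > 0" "poly b' r \<noteq> 0 \<Longrightarrow> ?e * poly b' r > 0"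
        using alternates_sign_at_root[OF less.prems(1,2,4,6) r simple[OF r]]
          alternates_sign_at_root[OF less.prems(1,3,5,7) r simple[OF r]] by blast+
      moreover have "poly b r \<noteq> 0 \<or> poly b' r \<noteq> 0" using False r by blast
      ultimately have "?e * poly b r + ?e * poly b' r > 0"
        by (cases "poly b r = 0"; cases "poly b' r = 0") (simp_all add: add_pos_pos)
      then have "poly p r * (?e * poly g r) > 0"
        using pg[OF r] by (metis distrib_left mult.left_commute)
      then show ?thesis using less.prems(11)[OF r] zero_less_mult_pos by blast
    qed
    then show ?thesis using alternates_simple_roots[OF less.prems(1) simple less.prems(9,8)] by blast
  qed
qed

section \<open>Nonpositive roots\<close>

text \<open>Positive leading coefficients prevent cancellation in sums, and such polynomials are
  positive on the positive axis.\<close>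

definition nonpos_rooted :: "real poly \<Rightarrow> bool" where
  "nonpos_rooted f \<longleftrightarrow> splits f \<and> lead_coeff f > 0 \<and> (\<forall>t>0. poly f t \<noteq> 0)"

lemma nonpos_rootedD:
  assumes "nonpos_rooted f"
  shows "splits f" "lead_coeff f > 0" "f \<noteq> 0" "\<And>t. poly f t = 0 \<Longrightarrow> t \<le> 0"
  using assms by (auto simp: nonpos_rooted_def splits_def not_le[symmetric])

lemma roots_ge_pos:
  assumes "nonpos_rooted f" "t > 0"
  shows "roots_ge f t = 0"
proof -
  have "filter_mset (\<lambda>r. t \<le> r) (proots f) = {#}"
    using nonpos_rootedD[OF assms(1)] assms(2) by (fastforce simp: filter_mset_eq_conv)
  then show ?thesis by (simp add: roots_ge_def)
qed

lemma nonpos_rooted_pos: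
  assumes "nonpos_rooted f" "t > 0"
  shows "poly f t > 0"
proof -
  have "poly f t \<noteq> 0" "f \<noteq> 0" using assms by (auto simp: nonpos_rooted_def)
  moreover from this have "roots_gt f t = 0"
    using roots_ge_pos[OF assms] roots_ge_eq_gt by fastforce
  ultimately show ?thesis
    using sign_poly_splits[of f t] assms by (auto simp: nonpos_rooted_def)
qed

lemma roots_ge_pCons_0:
  assumes "f \<noteq> 0"
  shows "roots_ge (pCons 0 f) t = (if t \<le> 0 then 1 else 0) + roots_ge f t"
  using roots_ge_linear_mult[OF assms, of 0] by simp

lemma nonpos_rooted_pCons_0:
  assumes "nonpos_rooted f"
  shows "nonpos_rooted (pCons 0 f)"
  using assms splits_linear_mult_iff[of 0 f] by (auto simp: nonpos_rooted_def)

lemma alternates_refl: "f \<unlhd> f"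
  by (simp add: alternates_def)

text \<open>The factor x raises the count of f by one for t \<le> 0; for t > 0 all counts vanish.
  The two inequalities defining \<open>\<unlhd>\<close> thus change places.\<close>

lemma alternates_pCons_0_iff:
  assumes "nonpos_rooted f" "nonpos_rooted g"
  shows "g \<unlhd> pCons 0 f \<longleftrightarrow> f \<unlhd> g"
proof -
  have z: "roots_ge f t = 0" "roots_ge g t = 0" if "\<not> t \<le> 0" for t
    using roots_ge_pos assms that by auto
  have "roots_ge g t \<le> roots_ge (pCons 0 f) t \<and> roots_ge (pCons 0 f) t \<le> roots_ge g t + 1 \<longleftrightarrow>
        roots_ge f t \<le> roots_ge g t \<and> roots_ge g t \<le> roots_ge f t + 1" for t
    unfolding roots_ge_pCons_0[OF nonpos_rootedD(3)[OF assms(1)]] using z[of t] by auto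
  then show ?thesis by (simp add: alternates_def)
qed

lemma alternates_pCons_0_mono:
  assumes "f \<noteq> 0" "g \<noteq> 0" "f \<unlhd> g"
  shows "pCons 0 f \<unlhd> pCons 0 g"
  using assms alternates_linear_mult_iff[of f g 0] by simp

section \<open>Sums of interlacing polynomials\<close>

lemma lead_coeff_add_pos:
  fixes f g :: "real poly"
  assumes "lead_coeff f > 0" "lead_coeff g > 0"
  shows "lead_coeff (f + g) > 0 \<and> degree (f + g) = max (degree f) (degree g)"
proof -
  consider "degree f < degree g" | "degree g < degree f" | "degree f = degree g" by linarith
  then show ?thesis
  proof cases
    case 3
    then have c: "coeff (f + g) (degree g) > 0" using assms by simp
    then have "degree g \<le> degree (f + g)" by (intro le_degree) simp
    then have "degree (f + g) = degree g"
      using degree_add_le[of f "degree g" g] 3 by simp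
    with c 3 show ?thesis by simp
  qed (use assms in \<open>auto simp: degree_add_eq_left degree_add_eq_right coeff_eq_0\<close>)
qed

lemma lead_coeff_sum_pos:
  fixes f :: "'a \<Rightarrow> real poly"
  assumes "finite I" "I \<noteq> {}" "\<And>i. i \<in> I \<Longrightarrow> lead_coeff (f i) > 0"
  shows "lead_coeff (sum f I) > 0 \<and> (\<forall>i\<in>I. degree (f i) \<le> degree (sum f I))"
  using assms
proof (induction rule: finite_ne_induct)
  case (insert i I)
  then show ?case using lead_coeff_add_pos[of "f i" "sum f I"] by (fastforce simp: le_max_iff_disj)
qed simp

lemma alternates_add_right:
  assumes "nonpos_rooted a" "nonpos_rooted b" "nonpos_rooted b'" "a \<unlhd> b" "a \<unlhd> b'"
  shows "nonpos_rooted (b + b') \<and> a \<unlhd> b + b'"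
proof -
  note D = nonpos_rootedD
  have L: "lead_coeff (b + b') > 0 \<and> degree (b + b') = max (degree b) (degree b')"
    using assms D by (intro lead_coeff_add_pos) auto
  have "degree (b + b') \<le> degree a + 1"
    using L alternates_degree[OF D(1)[OF assms(1)] D(1)[OF assms(2)] assms(4)]
      alternates_degree[OF D(1)[OF assms(1)] D(1)[OF assms(3)] assms(5)] by simp
  then have "splits (b + b') \<and> a \<unlhd> b + b'"
    using assms L D
    by (intro alternates_combination[of a b b' "b + b'" 1 0]) auto
  moreover have "poly (b + b') t \<noteq> 0" if "t > 0" for t
    using nonpos_rooted_pos[OF assms(2) that] nonpos_rooted_pos[OF assms(3) that] by simp
  ultimately show ?thesis using L by (auto simp: nonpos_rooted_def)
qed

text \<open>For nonpositive roots, \<open>f \<preceq> g\<close> is equivalent to \<open>g \<preceq> x f\<close>, which swaps the two sides.\<close>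

lemma alternates_add_left:
  assumes "nonpos_rooted a" "nonpos_rooted b" "nonpos_rooted b'" "b \<unlhd> a" "b' \<unlhd> a"
    and "nonpos_rooted (b + b')"
  shows "b + b' \<unlhd> a"
proof -
  have "a \<unlhd> pCons 0 b + pCons 0 b'"
    using assms by (intro alternates_add_right[THEN conjunct2])
      (auto simp: nonpos_rooted_pCons_0 alternates_pCons_0_iff)
  then have "a \<unlhd> pCons 0 (b + b')" by simp
  then show ?thesis using assms alternates_pCons_0_iff by blast
qed

lemma alternates_sum:
  assumes "finite I" "I \<noteq> {}" "nonpos_rooted a"
    and "\<And>i. i \<in> I \<Longrightarrow> nonpos_rooted (b i) \<and> a \<unlhd> b i \<and> b i \<unlhd> pCons 0 a"
  shows "nonpos_rooted (sum b I) \<and> a \<unlhd> sum b I \<and> sum b I \<unlhd> pCons 0 a"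
  using assms
proof (induction rule: finite_ne_induct)
  case (insert i I)
  then have IH: "nonpos_rooted (sum b I)" "a \<unlhd> sum b I" "sum b I \<unlhd> pCons 0 a" and
    i: "nonpos_rooted (b i)" "a \<unlhd> b i" "b i \<unlhd> pCons 0 a" by auto
  have s: "sum b (insert i I) = b i + sum b I" using insert by simp
  have n: "nonpos_rooted (b i + sum b I) \<and> a \<unlhd> b i + sum b I"
    using insert.prems(1) IH i by (intro alternates_add_right)
  moreover have "b i + sum b I \<unlhd> pCons 0 a"
    using insert.prems(1) IH i n by (intro alternates_add_left) (auto simp: nonpos_rooted_pCons_0)
  ultimately show ?case using s by simp
qed simp

text \<open>Two consecutive refined Eulerian polynomials share a part u and differ in one summand, f
  against \<open>x f\<close>. Here \<open>u + f\<close> alternates with both u and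
  \<open>x f\<close>, hence with their sum.\<close>

lemma alternates_shift_summand:
  assumes "nonpos_rooted f" "nonpos_rooted u" "f \<unlhd> u" "u \<unlhd> pCons 0 f"
  shows "nonpos_rooted (u + f) \<and> nonpos_rooted (u + pCons 0 f) \<and> u + f \<unlhd> u + pCons 0 f"
proof -
  have x: "nonpos_rooted (pCons 0 f)" "f \<unlhd> pCons 0 f"
    using assms by (auto simp: nonpos_rooted_pCons_0 alternates_pCons_0_iff alternates_refl)
  have uf: "nonpos_rooted (u + f)" and ux: "nonpos_rooted (u + pCons 0 f)"
    using alternates_add_right[of f u f] alternates_add_right[of f u "pCons 0 f"]
      assms x alternates_refl
    by auto
  have "u + f \<unlhd> u" "u + f \<unlhd> pCons 0 f"
    using assms x uf alternates_refl by (auto intro!: alternates_add_left)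
  then have "u + f \<unlhd> u + pCons 0 f" using alternates_add_right uf x assms by blast
  with uf ux show ?thesis by blast
qed

text \<open>Interlacing of f with g bounds the counts of g from below. Interlacing of f' with
  \<open>(x - 1) g\<close> bounds them from above, the root 1 absorbing the surplus of one.\<close>

lemma alternates_divided_difference:
  assumes f: "nonpos_rooted f" "nonpos_rooted f'" "f \<unlhd> f'"
    and g: "lead_coeff g > 0" "[:-1, 1:] * g = pCons 0 f - f'"
  shows "nonpos_rooted g \<and> degree g = degree f \<and>
    (\<forall>t. roots_ge f t \<le> roots_ge g t \<and> roots_ge g t \<le> roots_ge f' t)"
proof -
  note D = nonpos_rootedD[OF f(1)] and D' = nonpos_rootedD[OF f(2)]
  have g0: "g \<noteq> 0" using g(1) by auto
  have deg: "degree f \<le> degree f'" "degree f' \<le> degree f + 1"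
    using alternates_degree[OF D(1) D'(1) f(3)] by auto
  have "degree ([:-1, 1:] * g) \<le> degree f + 1"
    unfolding g(2) using deg D(3) by (intro degree_diff_le) auto
  then have deg_g: "degree g \<le> degree f" using degree_linear_mult[OF g0, of 1] by simp
  \<comment> \<open>The multiplier \<open>2 - 2 x\<close> is positive at the nonpositive roots of f.
    As \<open>alternates_combination\<close> takes two summands, f' is used twice.\<close>
  have "[:2, -2:] * g = smult (-2) ([:-1, 1:] * g)"
    by (rule poly_eqI) (simp add: coeff_pCons numeral_poly split: nat.split)
  also have "\<dots> = f' + f' + [:0, -2:] * f" unfolding g(2)
    by (rule poly_eqI) (simp add: coeff_pCons numeral_poly split: nat.split)
  finally have "[:2, -2:] * g = f' + f' + [:0, -2:] * f" .
  moreover have "poly [:2, -2:] r > 0" if "poly f r = 0" for r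
    using D(4)[OF that] by simp
  ultimately have fg: "splits g \<and> f \<unlhd> g"
    using alternates_combination[of f f' f' g "[:2, -2:]" "[:0, -2:]"] D(1,2) D'(1,2) f(3) g(1) deg_g
    by auto
  then have "degree f \<le> degree g" using alternates_degree D(1) by blast
  have x: "nonpos_rooted (pCons 0 f)" "f' \<unlhd> pCons 0 f"
    using f by (auto simp: nonpos_rooted_pCons_0 alternates_pCons_0_iff)
  note Dx = nonpos_rootedD[OF x(1)]
  \<comment> \<open>Now f' takes the role of a, with \<open>x f\<close> as both summands and
    constant multiplier 2.\<close>
  have "[:2:] * ([:-1, 1:] * g) = pCons 0 f + pCons 0 f + [:-2:] * f'" unfolding g(2)
    by (rule poly_eqI) (simp add: coeff_pCons numeral_poly split: nat.split)
  moreover have "lead_coeff ([:-1, 1:] * g) > 0" using g(1) lead_coeff_linear_mult by metis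
  moreover have "degree ([:-1, 1:] * g) \<le> degree f' + 1"
    using degree_linear_mult[OF g0, of 1] deg_g deg by simp
  moreover have "poly [:2:] r > 0" for r :: real by simp
  ultimately have "f' \<unlhd> [:-1, 1:] * g"
    using alternates_combination[of f' "pCons 0 f" "pCons 0 f" "[:-1, 1:] * g" "[:2:]" "[:-2:]"]
      D'(1) Dx(1,2) x(2) by blast
  then have le: "roots_ge ([:-1, 1:] * g) t \<le> roots_ge f' t + 1" for t
    by (simp only: alternates_def)
  have up: "roots_ge g t \<le> roots_ge f' t" if "t \<le> 1" for t
    using le[of t] roots_ge_linear_mult[OF g0, of 1] that by simp
  \<comment> \<open>f' has no root from 1 on, so neither has g; this extends the bound to all
    t.\<close>
  have "roots_ge g 1 = 0" using up[of 1] roots_ge_pos[OF f(2), of 1] by simp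
  then have gt1: "roots_ge g t = 0" if "t \<ge> 1" for t using roots_ge_antimono[OF that, of g] by simp
  have upper: "roots_ge g t \<le> roots_ge f' t" for t using up gt1 by (cases "t \<le> 1") auto
  have "poly g t \<noteq> 0" if "t > 0" for t
  proof
    assume "poly g t = 0"
    then have "order t g > 0" using g0 order_root by blast
    then show False using upper[of t] roots_ge_pos[OF f(2) that] roots_ge_eq_gt[OF g0, of t] by simp
  qed
  then show ?thesis
    using fg g(1) upper deg_g \<open>degree f \<le> degree g\<close> by (auto simp: nonpos_rooted_def alternates_def)
qed

section \<open>Refined Eulerian polynomials\<close>

text \<open>
  The polynomial \<open>refined_eulerian n j\<close>, meaningful for \<open>j \<le> n\<close>, is the descent enumerator of the
  permutations of \<open>n + 1\<close> letters that begin with the letter of rank \<open>j\<close>, counted from \<open>0\<close>.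
\<close>

primrec refined_eulerian :: "nat \<Rightarrow> nat \<Rightarrow> real poly" where
  "refined_eulerian 0 j = 1"
| "refined_eulerian (Suc n) j =
     pCons 0 (\<Sum>i<j. refined_eulerian n i) + (\<Sum>i=j..n. refined_eulerian n i)"

declare refined_eulerian.simps [simp del]

lemma pCons_0_sum: "pCons 0 (sum f I) = (\<Sum>i\<in>I. pCons 0 (f i))"
proof (induction I rule: infinite_finite_induct)
  case (insert i I)
  have "pCons 0 (f i + sum f I) = pCons 0 (f i) + pCons 0 (sum f I)" by simp
  then show ?case using insert by (metis sum.insert)
qed auto

text \<open>Passing from j to \<open>Suc j\<close> changes only the summand with index j, which
  acquires a factor x; u collects the others.\<close>

lemma refined_eulerian_Suc_split:
  assumes "j \<le> n"
  defines "u \<equiv> \<Sum>i\<in>{..n} - {j}.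
    if i < j then pCons 0 (refined_eulerian n i) else refined_eulerian n i"
  shows "refined_eulerian (Suc n) j = u + refined_eulerian n j"
    and "refined_eulerian (Suc n) (Suc j) = u + pCons 0 (refined_eulerian n j)"
proof -
  let ?y = "\<lambda>i. if i < j then pCons 0 (refined_eulerian n i) else refined_eulerian n i"
  have "{..n} - {j} = {..<j} \<union> {Suc j..n}" using assms(1) by auto
  moreover have "sum ?y ({..<j} \<union> {Suc j..n}) = sum ?y {..<j} + sum ?y {Suc j..n}"
    by (rule sum.union_disjoint) auto
  moreover have "sum ?y {..<j} = (\<Sum>i<j. pCons 0 (refined_eulerian n i))"
    by (rule sum.cong) auto
  moreover have "sum ?y {Suc j..n} = (\<Sum>i=Suc j..n. refined_eulerian n i)"
    by (rule sum.cong) auto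
  ultimately have u:
    "u = pCons 0 (\<Sum>i<j. refined_eulerian n i) + (\<Sum>i=Suc j..n. refined_eulerian n i)"
    unfolding u_def pCons_0_sum by (simp only:)
  show "refined_eulerian (Suc n) j = u + refined_eulerian n j"
    unfolding u refined_eulerian.simps sum.atLeast_Suc_atMost[OF assms(1)] by (simp only: ac_simps)
  show "refined_eulerian (Suc n) (Suc j) = u + pCons 0 (refined_eulerian n j)"
    unfolding u refined_eulerian.simps pCons_0_sum by (simp add: ac_simps)
qed

lemma refined_eulerian_Suc_Suc:
  assumes "j \<le> n"
  shows "refined_eulerian (Suc n) (Suc j) =
    refined_eulerian (Suc n) j + [:-1, 1:] * refined_eulerian n j"
  using refined_eulerian_Suc_split[OF assms] by simp

text \<open>A largest first letter is always followed by a descent, a smallest one never.\<close>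

lemma refined_eulerian_last:
  "refined_eulerian (Suc n) (Suc n) = pCons 0 (refined_eulerian (Suc n) 0)"
  by (simp add: refined_eulerian.simps lessThan_Suc_atMost atLeast0AtMost)

text \<open>Counts increase along the chain, and from \<open>f 0\<close> to \<open>x f 0\<close>
  they grow by at most one in total.\<close>

lemma alternates_chain:
  assumes "\<And>j. j \<le> n \<Longrightarrow> nonpos_rooted (f j) \<and> f j \<unlhd> f (Suc j)"
    and "f (Suc n) = pCons 0 (f 0)" "i \<le> j" "j \<le> Suc n"
  shows "f i \<unlhd> f j"
proof -
  have mono: "roots_ge (f i) t \<le> roots_ge (f j) t" if "i \<le> j" "j \<le> Suc n" for i j t
    using that
  proof (induction rule: dec_induct)
    case (step m)
    then show ?case using assms(1)[of m] by (simp add: alternates_def) (meson order_trans)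
  qed simp
  have "roots_ge (f j) t \<le> roots_ge (f i) t + 1" for t
  proof -
    have "f 0 \<noteq> 0" using assms(1)[of 0] nonpos_rootedD(3) by blast
    have "roots_ge (f j) t \<le> roots_ge (f (Suc n)) t" using mono[OF assms(4)] by simp
    also have "\<dots> \<le> roots_ge (f 0) t + 1"
      unfolding assms(2) roots_ge_pCons_0[OF \<open>f 0 \<noteq> 0\<close>] by simp
    finally show ?thesis using mono[of 0 i t] assms(3,4) by simp
  qed
  with mono[OF assms(3,4)] show ?thesis by (simp add: alternates_def)
qed

lemma refined_eulerian_interlacing:
  shows "j \<le> n \<Longrightarrow> nonpos_rooted (refined_eulerian n j)"
    and "i \<le> j \<Longrightarrow> j \<le> n \<Longrightarrow> refined_eulerian n i \<unlhd> refined_eulerian n j"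
proof (induction n arbitrary: i j)
  case 0
  {
    case 1
    then show ?case by (simp add: refined_eulerian.simps nonpos_rooted_def splits_def)
  next
    case 2
    then show ?case by (simp add: alternates_refl)
  }
next
  case (Suc n)
  have step: "nonpos_rooted (refined_eulerian (Suc n) j) \<and>
      nonpos_rooted (refined_eulerian (Suc n) (Suc j)) \<and>
      refined_eulerian (Suc n) j \<unlhd> refined_eulerian (Suc n) (Suc j)" if j: "j \<le> n" for j
  proof (cases "{..n} - {j} = {}")
    \<comment> \<open>Here n = 0, so the common part u is an empty sum, which
      \<open>alternates_sum\<close> excludes.\<close>
    case True
    have f: "nonpos_rooted (refined_eulerian n j)" using Suc.IH(1) j by blast
    then show ?thesis
      unfolding refined_eulerian_Suc_split[OF j] True
      by (simp add: nonpos_rooted_pCons_0 alternates_pCons_0_iff alternates_refl)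
  next
    case False
    define f where "f = refined_eulerian n"
    have f: "nonpos_rooted (f i)" if "i \<le> n" for i using Suc.IH(1) that by (simp add: f_def)
    have le: "f i \<unlhd> f k" if "i \<le> k" "k \<le> n" for i k using Suc.IH(2) that by (simp add: f_def)
    \<comment> \<open>Indices i < j give \<open>f i \<unlhd> f j\<close>, and the factor x turns
      this into alternation on the same side of \<open>f j\<close> as for i > j.\<close>
    have "nonpos_rooted (if i < j then pCons 0 (f i) else f i) \<and>
       f j \<unlhd> (if i < j then pCons 0 (f i) else f i) \<and>
       (if i < j then pCons 0 (f i) else f i) \<unlhd> pCons 0 (f j)" if "i \<in> {..n} - {j}" for i
    proof (cases "i < j")
      case True
      then show ?thesis
        using f[of i] f[of j] le[of i j] j nonpos_rootedD(3)
        by (auto simp: nonpos_rooted_pCons_0 alternates_pCons_0_iff intro!: alternates_pCons_0_mono)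
    next
      case False
      then show ?thesis
        using f[of i] f[of j] le[of j i] that j by (auto simp: alternates_pCons_0_iff)
    qed
    then have "nonpos_rooted (\<Sum>i\<in>{..n} - {j}. if i < j then pCons 0 (f i) else f i) \<and>
      f j \<unlhd> (\<Sum>i\<in>{..n} - {j}. if i < j then pCons 0 (f i) else f i) \<and>
      (\<Sum>i\<in>{..n} - {j}. if i < j then pCons 0 (f i) else f i) \<unlhd> pCons 0 (f j)"
      using False f[OF j] by (intro alternates_sum) auto
    then show ?thesis
      using alternates_shift_summand f[OF j]
      unfolding refined_eulerian_Suc_split[OF j] f_def by blast
  qed
  {
    case 1
    then show ?case using step by (cases j) auto
  next
    case 2
    then show ?case
      using alternates_chain[of n "refined_eulerian (Suc n)"] step refined_eulerian_last by blast
  }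
qed

text \<open>Combinatorially, only the decreasing word has n descents, and it begins with the letter
  of rank n.\<close>

lemma degree_refined_eulerian_le:
  "j \<le> n \<Longrightarrow> degree (refined_eulerian n j) \<le> (if j < n then n - 1 else n)"
proof (induction n arbitrary: j)
  case 0
  then show ?case by (simp add: refined_eulerian.simps)
next
  case (Suc n)
  have "degree (\<Sum>i=j..n. refined_eulerian n i) \<le> n"
    using Suc.IH by (intro degree_sum_le) (fastforce intro: order_trans split: if_splits)+
  moreover have "degree (pCons 0 (\<Sum>i<j. refined_eulerian n i)) \<le> (if j \<le> n then n else Suc n)"
  proof (cases "j = 0")
    case False
    have "degree (\<Sum>i<j. refined_eulerian n i) \<le> (if j \<le> n then n - 1 else n)"
    proof (rule degree_sum_le)
      fix i assume "i \<in> {..<j}"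
      then show "degree (refined_eulerian n i) \<le> (if j \<le> n then n - 1 else n)"
        using Suc.IH[of i] Suc.prems by (auto split: if_splits)
    qed simp
    then show ?thesis using False degree_pCons_le[of 0 "\<Sum>i<j. refined_eulerian n i"]
      by (auto split: if_splits)
  qed simp
  ultimately show ?case
    unfolding refined_eulerian.simps by (intro degree_add_le) (auto split: if_splits)
qed

text \<open>Without cancellation, the sum over all first letters has at least the degree of its last
  term, which is x times the polynomial for rank 0.\<close>

lemma degree_refined_eulerian_0_ge: "n \<le> degree (refined_eulerian (Suc n) 0)"
proof (induction n)
  case (Suc n)
  have "refined_eulerian (Suc (Suc n)) 0 = (\<Sum>i=0..Suc n. refined_eulerian (Suc n) i)"
    by (simp add: refined_eulerian.simps(2)[of "Suc n"])
  moreover have "degree (refined_eulerian (Suc n) (Suc n)) \<le>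
      degree (\<Sum>i=0..Suc n. refined_eulerian (Suc n) i)"
    using lead_coeff_sum_pos[of "{0..Suc n}" "refined_eulerian (Suc n)"]
      refined_eulerian_interlacing(1)[of _ "Suc n"] nonpos_rootedD(2) by auto
  moreover have "refined_eulerian (Suc n) 0 \<noteq> 0"
    using refined_eulerian_interlacing(1)[of 0 "Suc n"] nonpos_rootedD(3) by blast
  ultimately show ?case using Suc by (simp add: refined_eulerian_last)
qed simp

lemma degree_refined_eulerian:
  assumes "j < n"
  shows "degree (refined_eulerian n j) = n - 1"
proof -
  obtain m where m: "n = Suc m" using assms by (cases n) auto
  have "degree (refined_eulerian n 0) \<le> degree (refined_eulerian n j)"
    using alternates_degree refined_eulerian_interlacing assms nonpos_rootedD(1)
    by (metis less_imp_le zero_le)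
  then show ?thesis
    using degree_refined_eulerian_0_ge[of m] degree_refined_eulerian_le[of j n] assms m by simp
qed

section \<open>Recurrences for the polynomials \<open>p\<close> and \<open>\<ell>\<close>\<close>

text \<open>Pascal's rule; the shifted half carries a factor x - 1 and lowers m by one.\<close>

lemma p_poly_Suc: "p_poly m (Suc k) = p_poly m k + [:-1, 1:] * p_poly (m - 1) k"
proof -
  let ?t = "\<lambda>i. [:-1, 1:] ^ i * eulerian_poly (m - i)"
  have "p_poly m (Suc k) = (\<Sum>i=0..Suc k. of_nat (Suc k choose i) * ?t i)"
    by (simp add: p_poly_def mult.assoc)
  also have "\<dots> = ?t 0 + (\<Sum>i=0..k. of_nat (Suc k choose Suc i) * ?t (Suc i))"
    by (subst sum.atLeast0_atMost_Suc_shift) simp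
  also have "\<dots> = (?t 0 + (\<Sum>i=0..k. of_nat (k choose Suc i) * ?t (Suc i))) +
      (\<Sum>i=0..k. of_nat (k choose i) * ?t (Suc i))"
    by (simp only: binomial_Suc_Suc of_nat_add distrib_right sum.distrib
        add.assoc add.commute add.left_commute)
  also have "?t 0 + (\<Sum>i=0..k. of_nat (k choose Suc i) * ?t (Suc i)) =
      (\<Sum>i=0..Suc k. of_nat (k choose i) * ?t i)"
    by (subst sum.atLeast0_atMost_Suc_shift) simp
  also have "\<dots> = p_poly m k" by (simp add: p_poly_def mult.assoc)
  also have "(\<Sum>i=0..k. of_nat (k choose i) * ?t (Suc i)) = [:-1, 1:] * p_poly (m - 1) k"
    unfolding p_poly_def sum_distrib_left
    by (rule sum.cong) (simp_all only: power_Suc ac_simps diff_Suc_eq_diff_pred)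
  finally show ?thesis .
qed

lemma ell_poly_Suc_right: "ell_poly n k (Suc j) = ell_poly n k j + [:-1, 1:] * ell_poly (n - 1) k j"
  unfolding ell_poly_def p_poly_Suc sum_distrib_left distrib_left sum.distrib
  by (simp only: ac_simps diff_diff_left)

text \<open>The polynomial \<open>ell_poly n k j\<close> is a k-th backward difference in n of
  \<open>p_poly n j\<close>; again Pascal's rule.\<close>

lemma ell_poly_Suc: "ell_poly n (Suc k) j = ell_poly n k j - ell_poly (n - 1) k j"
proof -
  let ?t = "\<lambda>n i. (-1) ^ i * p_poly (n - i) j"
  have t: "ell_poly n k j = (\<Sum>i=0..k. of_nat (k choose i) * ?t n i)" for n k
    by (simp add: ell_poly_def ac_simps)
  have "ell_poly n (Suc k) j = ?t n 0 + (\<Sum>i=0..k. of_nat (Suc k choose Suc i) * ?t n (Suc i))"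
    unfolding t by (subst sum.atLeast0_atMost_Suc_shift) simp
  also have "\<dots> = (?t n 0 + (\<Sum>i=0..k. of_nat (k choose Suc i) * ?t n (Suc i))) +
      (\<Sum>i=0..k. of_nat (k choose i) * ?t n (Suc i))"
    by (simp only: binomial_Suc_Suc of_nat_add distrib_right sum.distrib
        add.assoc add.commute add.left_commute)
  also have "?t n 0 + (\<Sum>i=0..k. of_nat (k choose Suc i) * ?t n (Suc i)) =
      (\<Sum>i=0..Suc k. of_nat (k choose i) * ?t n i)"
    by (subst sum.atLeast0_atMost_Suc_shift) simp
  also have "\<dots> = ell_poly n k j" by (simp add: t)
  also have "(\<Sum>i=0..k. of_nat (k choose i) * ?t n (Suc i)) = - ell_poly (n - 1) k j"
    unfolding t by (simp flip: sum_negf)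
  finally show ?thesis by simp
qed

text \<open>Eliminates \<open>ell_poly (n - 1) k j\<close> from the recurrences in k and in
  j.\<close>

lemma ell_poly_divided_difference:
  "[:-1, 1:] * ell_poly n (Suc k) j = pCons 0 (ell_poly n k j) - ell_poly n k (Suc j)"
  unfolding ell_poly_Suc ell_poly_Suc_right by simp

section \<open>Permutations by first letter and descents\<close>

text \<open>Words over arbitrary letters allow deleting the first letter without
  relabelling.\<close>

fun list_des :: "nat list \<Rightarrow> nat" where
  "list_des (x # y # zs) = (if y < x then 1 else 0) + list_des (y # zs)"
| "list_des _ = 0"

lemma list_des_map_upt:
  assumes "a \<le> b"
  shows "list_des (map w [a..<Suc b]) = card {i \<in> {a..<b}. w i > w (i + 1)}"
  using assms
proof (induction rule: inc_induct)
  case (step a)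
  have "[a..<Suc b] = a # Suc a # [Suc (Suc a)..<Suc b]"
      "[Suc a..<Suc b] = Suc a # [Suc (Suc a)..<Suc b]"
    using step.hyps by (simp_all add: upt_rec)
  then have "list_des (map w [a..<Suc b]) =
      (if w (Suc a) < w a then 1 else 0) + card {i \<in> {Suc a..<b}. w i > w (i + 1)}"
    using step.IH by simp
  moreover have "{i \<in> {a..<b}. w i > w (i + 1)} =
      (if w (Suc a) < w a then insert a {i \<in> {Suc a..<b}. w i > w (i + 1)}
       else {i \<in> {Suc a..<b}. w i > w (i + 1)})"
    using step.hyps by (auto simp: le_less Suc_le_eq)
  ultimately show ?case by simp
qed simp

lemma des_eq_list_des: "des m w = list_des (map w [1..<Suc m])"
proof (cases m)
  case (Suc n)
  then show ?thesis unfolding des_def by (subst list_des_map_upt) auto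
qed (simp add: des_def)

text \<open>Injective because permutations fix everything outside {1..m}; surjective because both
  sets have m! elements.\<close>

lemma bij_betw_permutes_lists:
  "bij_betw (\<lambda>w. map w [1..<Suc m]) {w. w permutes {1..m}} (permutations_of_set {1..m})"
proof -
  let ?F = "\<lambda>w :: nat \<Rightarrow> nat. map w [1..<Suc m]"
  have inj: "inj_on ?F {w. w permutes {1..m}}"
  proof (rule inj_onI, rule ext)
    fix v w i
    assume vw: "v \<in> {w. w permutes {1..m}}" "w \<in> {w. w permutes {1..m}}" "?F v = ?F w"
    then have "\<forall>i\<in>{1..m}. v i = w i" by (auto simp: map_eq_conv simp del: upt_Suc)
    then show "v i = w i" using vw by (cases "i \<in> {1..m}") (auto simp: permutes_not_in)
  qed
  have "?F w \<in> permutations_of_set {1..m}" if "w permutes {1..m}" for w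
  proof (rule permutations_of_setI)
    have "set [1..<Suc m] = {1..m}" by auto
    then show "set (?F w) = {1..m}" using permutes_image[OF that] by (simp only: set_map)
    show "distinct (?F w)"
      using permutes_inj_on[OF that] by (simp add: distinct_map del: upt_Suc)
  qed
  then have "?F ` {w. w permutes {1..m}} \<subseteq> permutations_of_set {1..m}" by blast
  moreover have "card (?F ` {w. w permutes {1..m}}) = card (permutations_of_set {1..m})"
    using card_image[OF inj] card_permutations[of "{1..m}" m] by simp
  ultimately have "?F ` {w. w permutes {1..m}} = permutations_of_set {1..m}"
    by (intro card_subset_eq) auto
  with inj show ?thesis by (simp add: bij_betw_def)
qed

lemma eulerian_poly_lists:
  "eulerian_poly m = (\<Sum>xs\<in>permutations_of_set {1..m}. monom 1 (list_des xs))"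
  unfolding eulerian_poly_def des_eq_list_des
  using sum.reindex_bij_betw[OF bij_betw_permutes_lists, of "\<lambda>xs. monom 1 (list_des xs)" m] by simp

lemma bij_betw_rank:
  fixes T :: "nat set"
  assumes "finite T"
  shows "bij_betw (\<lambda>b. card {c \<in> T. c < b}) T {..<card T}"
proof -
  let ?r = "\<lambda>b. card {c \<in> T. c < b}"
  have mono: "?r b < ?r b'" if "b \<in> T" "b < b'" for b b'
    using assms that by (intro psubset_card_mono) auto
  have "inj_on ?r T" by (rule linorder_inj_onI') (use mono in force)
  moreover have "?r ` T \<subseteq> {..<card T}"
    using assms by (auto intro!: psubset_card_mono)
  ultimately show ?thesis
    by (simp add: bij_betw_def card_subset_eq card_image)
qed

lemma sum_permutations_of_set_Cons:
  assumes "finite T" "T \<noteq> {}"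
  shows "(\<Sum>ys\<in>permutations_of_set T. h ys) =
    (\<Sum>b\<in>T. \<Sum>ys\<in>permutations_of_set (T - {b}). h (b # ys))"
proof -
  have "(\<Sum>ys\<in>permutations_of_set T. h ys) =
      (\<Sum>b\<in>T. \<Sum>ys\<in>(#) b ` permutations_of_set (T - {b}). h ys)"
    unfolding permutations_of_set_nonempty[OF assms(2)]
    using assms by (intro sum.UNION_disjoint) auto
  then show ?thesis by (simp add: sum.reindex)
qed

text \<open>Sum over the second letter b, which creates a descent exactly when its rank in T is
  below that of a. Ranks run through 0, ..., n, so the defining recurrence appears.\<close>

lemma sum_list_des_Cons:
  assumes "finite T" "a \<notin> T"
  shows "(\<Sum>ys\<in>permutations_of_set T. monom 1 (list_des (a # ys)))
    = refined_eulerian (card T) (card {b \<in> T. b < a})"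
  using assms
proof (induction "card T" arbitrary: T a)
  case 0
  then show ?case by (simp add: refined_eulerian.simps)
next
  case (Suc n)
  let ?r = "\<lambda>b. card {c \<in> T. c < b}"
  let ?y = "\<lambda>i. if i < ?r a then pCons 0 (refined_eulerian n i) else refined_eulerian n i"
  have T: "T \<noteq> {}" "?r a \<le> Suc n"
    using Suc.hyps(2) Suc.prems(1) card_mono[of T "{c \<in> T. c < a}"] by auto
  have inner: "(\<Sum>ys\<in>permutations_of_set (T - {b}). monom 1 (list_des (a # b # ys))) = ?y (?r b)"
    if b: "b \<in> T" for b
  proof -
    have "b \<noteq> a" using b Suc.prems by blast
    \<comment> \<open>Removing b from T leaves the rank of b unchanged.\<close>
    have "{c \<in> T - {b}. c < b} = {c \<in> T. c < b}" by auto
    moreover have "n = card (T - {b})" using Suc.hyps(2) Suc.prems(1) b by simp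
    ultimately have IH: "(\<Sum>ys\<in>permutations_of_set (T - {b}). monom 1 (list_des (b # ys))) =
        refined_eulerian n (?r b)"
      using Suc.hyps(1)[of "T - {b}" b] Suc.prems(1) by simp
    show ?thesis
    proof (cases "b < a")
      case True
      then have "?r b < ?r a" using b Suc.prems(1) by (intro psubset_card_mono) auto
      then show ?thesis using True by (simp add: monom_Suc IH flip: pCons_0_sum)
    next
      case False
      then have "?r a \<le> ?r b" using Suc.prems(1) by (intro card_mono) auto
      then show ?thesis using False by (simp add: IH)
    qed
  qed
  have "(\<Sum>ys\<in>permutations_of_set T. monom 1 (list_des (a # ys))) = (\<Sum>b\<in>T. ?y (?r b))"
    unfolding sum_permutations_of_set_Cons[OF Suc.prems(1) T(1)] using inner by (intro sum.cong) auto
  also have "\<dots> = sum ?y {..<Suc n}"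
    using sum.reindex_bij_betw[OF bij_betw_rank[OF Suc.prems(1)], of ?y] Suc.hyps(2) by simp
  also have "{..<Suc n} = {..<?r a} \<union> {?r a..n}" using T(2) by auto
  also have "sum ?y \<dots> = sum ?y {..<?r a} + sum ?y {?r a..n}" by (rule sum.union_disjoint) auto
  also have "sum ?y {..<?r a} = pCons 0 (\<Sum>i<?r a. refined_eulerian n i)"
    unfolding pCons_0_sum by (rule sum.cong) auto
  also have "sum ?y {?r a..n} = (\<Sum>i=?r a..n. refined_eulerian n i)" by (rule sum.cong) auto
  finally show ?case by (simp add: refined_eulerian.simps flip: Suc.hyps(2))
qed

text \<open>Prefixing the letter \<open>0\<close> creates no descent.\<close>

lemma eulerian_poly_eq: "eulerian_poly n = refined_eulerian n 0"
proof -
  have "list_des (0 # xs) = list_des xs" if "xs \<in> permutations_of_set {1..n}" for xs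
    using permutations_of_setD(1)[OF that] by (cases xs) auto
  then have "eulerian_poly n = (\<Sum>xs\<in>permutations_of_set {1..n}. monom 1 (list_des (0 # xs)))"
    unfolding eulerian_poly_lists by (intro sum.cong) auto
  then show ?thesis using sum_list_des_Cons[of "{1..n}" 0] by simp
qed

section \<open>Interlacing of the polynomials \<open>\<ell>\<close>\<close>

text \<open>Both sides satisfy the same recurrence in j, starting from the Eulerian
  polynomial.\<close>

lemma p_poly_eq: "j \<le> n \<Longrightarrow> p_poly n j = refined_eulerian n j"
proof (induction j arbitrary: n)
  case 0
  then show ?case by (simp add: p_poly_def eulerian_poly_eq)
next
  case (Suc j)
  then obtain m where "n = Suc m" by (cases n) auto
  with Suc show ?case unfolding p_poly_Suc by (simp only: refined_eulerian_Suc_Suc) simp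
qed

lemma ell_poly_0: "ell_poly n 0 j = p_poly n j"
  by (simp add: ell_poly_def)

text \<open>At k = 0 the last polynomial has larger degree than its predecessor, so leading terms
  may cancel in the divided difference. Instead, \<open>ell_poly n 1 j\<close> is the common part u,
  a sum that is nonempty for n \<ge> 2.\<close>

lemma lead_coeff_ell_poly_1:
  assumes "n \<ge> 2" "j < n"
  shows "lead_coeff (ell_poly n (Suc 0) j) > 0"
proof -
  obtain m where m: "n = Suc m" "m \<ge> 1" "j \<le> m" using assms by (cases n) auto
  let ?y = "\<lambda>i. if i < j then pCons 0 (refined_eulerian m i) else refined_eulerian m i"
  have "ell_poly n (Suc 0) j = sum ?y ({..m} - {j})"
    using m refined_eulerian_Suc_split(1)[OF m(3)] by (simp add: ell_poly_Suc ell_poly_0 p_poly_eq)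
  moreover have "(if j = 0 then 1 else 0) \<in> {..m} - {j}" using m by auto
  then have "{..m} - {j} \<noteq> {}" by blast
  moreover have "lead_coeff (?y i) > 0" if "i \<in> {..m} - {j}" for i
    using that refined_eulerian_interlacing(1)[of i m] nonpos_rootedD(2,3) by auto
  ultimately show ?thesis using lead_coeff_sum_pos[of "{..m} - {j}" ?y] by simp
qed

lemma lead_coeff_divided_difference:
  fixes f f' g :: "real poly"
  assumes "[:-1, 1:] * g = pCons 0 f - f'" "degree f' \<le> degree f" "lead_coeff f > 0"
  shows "lead_coeff g > 0"
proof -
  have "degree (- f') < degree (pCons 0 f)" using assms by auto
  from lead_coeff_add_le[OF this] have "lead_coeff (pCons 0 f - f') = lead_coeff f"
    using assms(3) by (auto simp: algebra_simps)
  then show ?thesis using assms lead_coeff_linear_mult by metis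
qed

text \<open>Induction on k, squeezing the counts at level \<open>Suc k\<close> between those of
  neighbours at level k. The degree clause secures the positive leading coefficient at the next
  level.\<close>

lemma ell_poly_interlacing:
  assumes "n \<ge> 2"
  shows "k \<le> n \<Longrightarrow> j \<le> n - k \<Longrightarrow> nonpos_rooted (ell_poly n k j)
      \<and> eulerian_poly n \<unlhd> ell_poly n k j
      \<and> (k > 0 \<longrightarrow> degree (ell_poly n k j) = n - 1)"
    and "k \<le> n \<Longrightarrow> i \<le> j \<Longrightarrow> j \<le> n - k \<Longrightarrow> ell_poly n k i \<unlhd> ell_poly n k j"
proof (induction k arbitrary: i j)
  case 0
  {
    case 1
    then show ?case
      using refined_eulerian_interlacing by (simp add: ell_poly_0 p_poly_eq eulerian_poly_eq)
  next
    case 2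
    then show ?case using refined_eulerian_interlacing by (simp add: ell_poly_0 p_poly_eq)
  }
next
  case (Suc k)
  define f where "f = ell_poly n k"
  define g where "g = ell_poly n (Suc k)"
  \<comment> \<open>Level k has one index more than level \<open>Suc k\<close>, so
    \<open>f (Suc j)\<close> is available for every j that occurs in g.\<close>
  have f: "nonpos_rooted (f j)" "eulerian_poly n \<unlhd> f j" "k > 0 \<longrightarrow> degree (f j) = n - 1"
    if "Suc k \<le> n" "j \<le> Suc (n - Suc k)" for j
    using Suc.IH(1)[of j] that by (auto simp: f_def)
  have ff: "f i \<unlhd> f j" if "Suc k \<le> n" "i \<le> j" "j \<le> Suc (n - Suc k)" for i j
    using Suc.IH(2)[of i j] that by (auto simp: f_def)
  have g: "nonpos_rooted (g j) \<and> degree (g j) = degree (f j) \<and>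
      (\<forall>t. roots_ge (f j) t \<le> roots_ge (g j) t \<and> roots_ge (g j) t \<le> roots_ge (f (Suc j)) t)"
    if j: "Suc k \<le> n" "j \<le> n - Suc k" for j
  proof -
    have eq: "[:-1, 1:] * g j = pCons 0 (f j) - f (Suc j)"
      unfolding f_def g_def by (rule ell_poly_divided_difference)
    have "lead_coeff (g j) > 0"
    proof (cases "k = 0")
      case True
      then show ?thesis unfolding g_def using lead_coeff_ell_poly_1[OF assms] j by simp
    next
      case False
      then show ?thesis
        using f[of j] f[of "Suc j"] j nonpos_rootedD(2)[of "f j"]
        by (intro lead_coeff_divided_difference[OF eq]) auto
    qed
    then show ?thesis
      using f[of j] f[of "Suc j"] ff[of j "Suc j"] j eq
      by (intro alternates_divided_difference) auto
  qed
  {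
    case 1
    have "roots_ge (eulerian_poly n) t \<le> roots_ge (f j) t"
      "roots_ge (f (Suc j)) t \<le> roots_ge (eulerian_poly n) t + 1" for t
      using f(2)[of j] f(2)[of "Suc j"] 1 unfolding alternates_def by auto
    then have "eulerian_poly n \<unlhd> g j"
      using g[of j] 1 unfolding alternates_def by (meson order_trans)
    moreover have "degree (f j) = n - 1"
    proof (cases "k = 0")
      case True
      then show ?thesis using 1 by (simp add: f_def ell_poly_0 p_poly_eq degree_refined_eulerian)
    qed (use f[of j] 1 in auto)
    ultimately show ?case using g[of j] 1 by (simp add: g_def)
  next
    case (2 i j)
    show ?case
    proof (cases "i = j")
      case False
      then have ij: "Suc i \<le> j" "i \<le> n - Suc k" "Suc k \<le> n" "j \<le> n - Suc k" using 2 by auto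
      have "roots_ge (g i) t \<le> roots_ge (g j) t \<and> roots_ge (g j) t \<le> roots_ge (g i) t + 1" for t
      proof -
        \<comment> \<open>For i < j the counts at t satisfy g_i \<le> f_(i+1) \<le> f_j \<le> g_j
          and g_j \<le> f_(j+1) \<le> f_i + 1 \<le> g_i + 1.\<close>
        have "roots_ge (f (Suc i)) t \<le> roots_ge (f j) t" "roots_ge (f (Suc j)) t \<le> roots_ge (f i) t + 1"
          using ff[of "Suc i" j] ff[of i "Suc j"] ij unfolding alternates_def by auto
        moreover have "roots_ge (f i) t \<le> roots_ge (g i) t" "roots_ge (g i) t \<le> roots_ge (f (Suc i)) t"
          "roots_ge (f j) t \<le> roots_ge (g j) t" "roots_ge (g j) t \<le> roots_ge (f (Suc j)) t"
          using g ij by auto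
        ultimately show ?thesis by linarith
      qed
      then show ?thesis by (simp add: alternates_def g_def)
    qed (simp add: alternates_refl)
  }
qed

theorem theorem4p1:
  fixes n k :: nat
  assumes "k \<le> n"
  shows "interlacing_seq (n - k) (\<lambda>j. ell_poly n k j) \<and>
         (\<forall>j \<le> n - k. eulerian_poly n \<preceq> ell_poly n k j)"
proof -
  have A: "splits (eulerian_poly n)"
    using refined_eulerian_interlacing(1)[of 0 n] nonpos_rootedD(1) by (simp add: eulerian_poly_eq)
  show ?thesis
  proof (cases "n \<ge> 2 \<or> k = 0")
    case True
    have "splits (ell_poly n k j)" "eulerian_poly n \<unlhd> ell_poly n k j" if "j \<le> n - k" for j
      using True ell_poly_interlacing(1)[of n k j] refined_eulerian_interlacing(1)[of j n]
        refined_eulerian_interlacing(2)[of 0 j n] nonpos_rootedD(1) that assms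
      by (auto simp: ell_poly_0 p_poly_eq eulerian_poly_eq)
    moreover have "ell_poly n k i \<unlhd> ell_poly n k j" if "i \<le> j" "j \<le> n - k" for i j
      using True ell_poly_interlacing(2)[of n k i j] refined_eulerian_interlacing(2)[of i j n]
        that assms
      by (auto simp: ell_poly_0 p_poly_eq)
    ultimately show ?thesis
      using A by (auto simp: interlacing_seq_def intro!: splits_imp_real_rooted alternates_imp_interlaces)
  next
    \<comment> \<open>In the remaining case the only term is p_(1,0) - p_(0,0) = 0, covered by the
      convention for the zero polynomial.\<close>
    case False
    with assms have "n = 1" "k = 1" by auto
    then have "ell_poly n k 0 = 0"
      by (simp add: ell_poly_Suc ell_poly_0 p_poly_eq refined_eulerian.simps)
    with \<open>n = 1\<close> \<open>k = 1\<close> show ?thesis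
      using splits_imp_real_rooted[OF A]
      by (simp add: interlacing_seq_def interlaces_def real_rooted_def)
  qed
qed

end
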